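(* Let $W=W(F_4)$ be the Coxeter group of type $F_4$ with longest element $w_o$ (which is central and acts as $-1$ in the reflection representation). The involutions in $W$ form exactly eight conjugacy classes, namely the pairwise distinct classes $[w_\emptyset]$, $[w_{\{1,2,3,4\}}]$, $[w_{\{1\}}]=[w_{\{2\}}]$, $[w_{\{2,3,4\}}]$, $[w_{\{3\}}]=[w_{\{4\}}]$, $[w_{\{1,2,3\}}]$, $[w_{\{1,3\}}]=[w_{\{1,4\}}]$, $[w_{\{2,3\}}]$. Multiplication by $w_o=-1$ acts on these classes as follows: (1) it interchanges $[w_\emptyset]$ and $[w_{\{1,2,3,4\}}]$; (2) it interchanges $[w_{\{1\}}]$ and $[w_{\{2,3,4\}}]$; (3) it interchanges $[w_{\{3\}}]$ and $[w_{\{1,2,3\}}]$; (4) it fixes $[w_{\{1,3\}}]$; (5) it fixes $[w_{\{2,3\}}]$.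
   Context: The Coxeter graph $F_4$ is the path with nodes $1,2,3,4$, in which the edge between $2$ and $3$ has label $4$ and the other two edges have label $3$. Node $i$ corresponds to the simple generator $s_i$. For a set of nodes $I$, $W_I$ denotes the parabolic subgroup generated by $\{s_i: i\in I\}$, and $w_I$ denotes its longest element ($w_\emptyset=1$). An involution is an element $x$ with $x^2=1$ (the identity is included); $[x]$ denotes the conjugacy class of $x$ in $W$. *)

theory Defs
  imports "HOL-Analysis.Analysis" "HOL-Algebra.Generated_Groups"
begin

text \<open>
  Coxeter groups by generators and relations. The type \<open>'s\<close> is the set of nodes and
  \<open>m s t\<close> is the entry of the Coxeter matrix; \<open>m s t = 0\<close> stands for the label infinity
  (the relation is then vacuous). The relations \<open>s\<^sup>2 = 1\<close>, coming from \<open>m s s = 1\<close>, make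
  every generator its own inverse, so words in the generators suffice and formal inverses are
  not needed.
\<close>

inductive cox_equiv :: "('s \<Rightarrow> 's \<Rightarrow> nat) \<Rightarrow> 's list \<Rightarrow> 's list \<Rightarrow> bool"
  for m :: "'s \<Rightarrow> 's \<Rightarrow> nat" where
  cox_relation: "cox_equiv m (u @ concat (replicate (m s t) [s, t]) @ v) (u @ v)"
| cox_refl: "cox_equiv m u u"
| cox_sym: "cox_equiv m u v \<Longrightarrow> cox_equiv m v u"
| cox_trans: "cox_equiv m u v \<Longrightarrow> cox_equiv m v w \<Longrightarrow> cox_equiv m u w"

definition cox_elem :: "('s \<Rightarrow> 's \<Rightarrow> nat) \<Rightarrow> 's list \<Rightarrow> 's list set" where
  "cox_elem m u = {v. cox_equiv m u v}"

definition coxeter_group :: "('s \<Rightarrow> 's \<Rightarrow> nat) \<Rightarrow> 's list set monoid" where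
  "coxeter_group m =
     \<lparr>carrier = range (cox_elem m),
      mult = (\<lambda>x y. \<Union>u\<in>x. \<Union>v\<in>y. cox_elem m (u @ v)),
      one = cox_elem m []\<rparr>"

definition simple_gen :: "('s \<Rightarrow> 's \<Rightarrow> nat) \<Rightarrow> 's \<Rightarrow> 's list set" where
  "simple_gen m s = cox_elem m [s]"

definition parabolic :: "('s \<Rightarrow> 's \<Rightarrow> nat) \<Rightarrow> 's set \<Rightarrow> 's list set set" where
  "parabolic m I = generate (coxeter_group m) (simple_gen m ` I)"

definition cox_length :: "('s \<Rightarrow> 's \<Rightarrow> nat) \<Rightarrow> 's list set \<Rightarrow> nat" where
  "cox_length m x = (LEAST n. \<exists>u. length u = n \<and> cox_elem m u = x)"

definition longest_elem :: "('s \<Rightarrow> 's \<Rightarrow> nat) \<Rightarrow> 's set \<Rightarrow> 's list set" where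
  "longest_elem m I =
     (THE x. x \<in> parabolic m I \<and> (\<forall>y\<in>parabolic m I. cox_length m y \<le> cox_length m x))"

text \<open>
  The reflection representation on the span of the simple roots \<open>axis s 1\<close>. For
  \<open>m s t = 0\<close> the form takes the value \<open>-1\<close>, since \<open>pi / 0 = 0\<close>.
\<close>

definition cox_form :: "('s::finite \<Rightarrow> 's \<Rightarrow> nat) \<Rightarrow> real^'s \<Rightarrow> real^'s \<Rightarrow> real" where
  "cox_form m v w = (\<Sum>s\<in>UNIV. \<Sum>t\<in>UNIV. v $ s * w $ t * (- cos (pi / real (m s t))))"

definition simple_reflection :: "('s::finite \<Rightarrow> 's \<Rightarrow> nat) \<Rightarrow> 's \<Rightarrow> real^'s \<Rightarrow> real^'s" where
  "simple_reflection m s v = v - (2 * cox_form m (axis s 1) v) *\<^sub>R axis s 1"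

definition word_action :: "('s::finite \<Rightarrow> 's \<Rightarrow> nat) \<Rightarrow> 's list \<Rightarrow> real^'s \<Rightarrow> real^'s" where
  "word_action m u = foldr (simple_reflection m) u"

text \<open>
  All words representing \<open>x\<close> act by the same map, which \<open>the_elem\<close> picks out. An equation
  \<open>refl_rep m x = f\<close> can only be proved by way of that independence.
\<close>

definition refl_rep :: "('s::finite \<Rightarrow> 's \<Rightarrow> nat) \<Rightarrow> 's list set \<Rightarrow> real^'s \<Rightarrow> real^'s" where
  "refl_rep m x = the_elem (word_action m ` x)"

definition involutions :: "('a, 'b) monoid_scheme \<Rightarrow> 'a set" where
  "involutions G = {x \<in> carrier G. x \<otimes>\<^bsub>G\<^esub> x = \<one>\<^bsub>G\<^esub>}"

definition conj_class :: "('a, 'b) monoid_scheme \<Rightarrow> 'a \<Rightarrow> 'a set" where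
  "conj_class G x = {g \<otimes>\<^bsub>G\<^esub> x \<otimes>\<^bsub>G\<^esub> inv\<^bsub>G\<^esub> g |g. g \<in> carrier G}"

text \<open>
  The nodes are the elements \<open>1, 2, 3, 4\<close> of the four-element type \<open>4\<close>. They are pairwise
  distinct and exhaust the type (arithmetic in it is modulo four, so \<open>4 = 0\<close>).
\<close>

definition F4 :: "4 \<Rightarrow> 4 \<Rightarrow> nat" where
  "F4 s t =
     (if s = t then 1
      else if {s, t} = {2, 3} then 4
      else if {s, t} = {1, 2} \<or> {s, t} = {3, 4} then 3
      else 2)"

abbreviation W_F4 :: "4 list set monoid" where
  "W_F4 \<equiv> coxeter_group F4"

abbreviation w_F4 :: "4 set \<Rightarrow> 4 list set" where
  "w_F4 I \<equiv> longest_elem F4 I"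

abbreviation cl_F4 :: "4 set \<Rightarrow> 4 list set set" where
  "cl_F4 I \<equiv> conj_class W_F4 (w_F4 I)"

lemma cox_elem_eq_iff: "cox_elem m u = cox_elem m v \<longleftrightarrow> cox_equiv m u v"
proof
  assume "cox_elem m u = cox_elem m v"
  then have "v \<in> cox_elem m u" by (simp add: cox_elem_def cox_refl)
  then show "cox_equiv m u v" by (simp add: cox_elem_def)
next
  assume "cox_equiv m u v"
  then have "cox_equiv m u w \<longleftrightarrow> cox_equiv m v w" for w
    using cox_sym cox_trans by metis
  then show "cox_elem m u = cox_elem m v" by (simp add: cox_elem_def)
qed

lemma cox_equiv_context: "cox_equiv m u v \<Longrightarrow> cox_equiv m (a @ u @ b) (a @ v @ b)"
proof (induction rule: cox_equiv.induct)
  case (cox_relation u s t v)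
  show ?case using cox_equiv.cox_relation[of m "a @ u" s t "v @ b"] by simp
next
  case cox_refl
  show ?case by (rule cox_equiv.cox_refl)
next
  case (cox_sym u v)
  show ?case by (rule cox_equiv.cox_sym) (rule cox_sym.IH)
next
  case (cox_trans u v w)
  show ?case by (rule cox_equiv.cox_trans) (rule cox_trans.IH)+
qed

lemma cox_equiv_append:
  assumes "cox_equiv m u u'" "cox_equiv m v v'"
  shows "cox_equiv m (u @ v) (u' @ v')"
proof (rule cox_trans)
  show "cox_equiv m (u @ v) (u' @ v)"
    using cox_equiv_context[OF assms(1), of "[]" v] by simp
  show "cox_equiv m (u' @ v) (u' @ v')"
    using cox_equiv_context[OF assms(2), of u' "[]"] by simp
qed

lemma coxeter_group_mult:
  "cox_elem m u \<otimes>\<^bsub>coxeter_group m\<^esub> cox_elem m v = cox_elem m (u @ v)"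
proof -
  have "cox_elem m (u' @ v') = cox_elem m (u @ v)"
    if "u' \<in> cox_elem m u" "v' \<in> cox_elem m v" for u' v'
  proof -
    have "cox_equiv m u u'" "cox_equiv m v v'"
      using that by (simp_all add: cox_elem_def)
    then show ?thesis
      using cox_sym[OF cox_equiv_append[of m u u' v v']] by (simp add: cox_elem_eq_iff)
  qed
  moreover have "u \<in> cox_elem m u" "v \<in> cox_elem m v"
    by (simp_all add: cox_elem_def cox_refl)
  ultimately have "(\<Union>u'\<in>cox_elem m u. \<Union>v'\<in>cox_elem m v. cox_elem m (u' @ v'))
      = cox_elem m (u @ v)"
    by blast
  then show ?thesis by (simp add: coxeter_group_def)
qed

lemma cox_equiv_rev_append:
  assumes "\<And>s. m s s = 1"
  shows "cox_equiv m (rev u @ u) []"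
proof (induction u)
  case Nil
  show ?case by (simp add: cox_refl)
next
  case (Cons s u)
  have "cox_equiv m (rev u @ [s, s] @ u) (rev u @ u)"
    using cox_relation[of m "rev u" s s u] assms by simp
  from cox_trans[OF this Cons.IH] show ?case by simp
qed

lemma group_coxeter_group:
  assumes "\<And>s. m s s = 1"
  shows "group (coxeter_group m)"
proof -
  have carr: "carrier (coxeter_group m) = range (cox_elem m)"
    and one: "\<one>\<^bsub>coxeter_group m\<^esub> = cox_elem m []"
    by (simp_all add: coxeter_group_def)
  show ?thesis
  proof (rule groupI)
    fix x assume "x \<in> carrier (coxeter_group m)"
    then obtain u where "x = cox_elem m u" by (auto simp: carr)
    then have "cox_elem m (rev u) \<otimes>\<^bsub>coxeter_group m\<^esub> x = \<one>\<^bsub>coxeter_group m\<^esub>"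
      using cox_equiv_rev_append[of m u] assms
      by (simp add: one coxeter_group_mult cox_elem_eq_iff)
    then show "\<exists>y\<in>carrier (coxeter_group m).
        y \<otimes>\<^bsub>coxeter_group m\<^esub> x = \<one>\<^bsub>coxeter_group m\<^esub>"
      by (auto simp: carr)
  qed (auto simp: carr one coxeter_group_mult)
qed

lemma group_W_F4: "group W_F4"
  by (rule group_coxeter_group) (simp add: F4_def)

end

theory Submission
  imports Defs
begin

text \<open>
  For a word \<open>u\<close> and a node \<open>s\<close>, the word \<open>u @ [s]\<close> is longer than \<open>u\<close> exactly if \<open>u\<close> sends the
  simple root of \<open>s\<close> to a nonnegative vector. Hence the reflection representation is faithful and a
  word over \<open>I\<close> represents \<open>w_I\<close> as soon as it sends all simple roots in \<open>I\<close> to nonpositive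
  vectors. A shortest involution in its class keeps each simple root positive or negates it; if \<open>I\<close>
  is the set of negated simple roots, the involution equals \<open>w_I\<close> (Richardson). So only those \<open>w_I\<close>
  matter that act as \<open>-1\<close> on the span of \<open>I\<close>. Two sign characters and the trace separate their
  classes. Multiplication by \<open>w_o = -1\<close> keeps the characters and negates the trace, which
  determines its effect on the classes.
\<close>

section \<open>Reduced words and the reflection representation\<close>

text \<open>Every relator has length \<open>2 * m s t\<close>, so the parity of a word depends only
  on its element.\<close>

lemma cox_equiv_even_length:
  "cox_equiv m u v \<Longrightarrow> even (length u) = even (length v)"
proof (induction rule: cox_equiv.induct)
  case (cox_relation u s t v)
  have "even (length (concat (replicate n [s, t])))" for n
    by (induction n) auto
  then show ?case by simp
qed auto

lemma cox_length_le: "cox_length m (cox_elem m u) \<le> length u"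
  unfolding cox_length_def by (rule Least_le) auto

lemma cox_length_attained:
  obtains v where "length v = cox_length m (cox_elem m u)" "cox_equiv m v u"
proof -
  have "\<exists>v. length v = cox_length m (cox_elem m u) \<and> cox_elem m v = cox_elem m u"
    unfolding cox_length_def by (rule LeastI) auto
  then show ?thesis
    using that by (auto simp: cox_elem_eq_iff)
qed

lemma cox_length_le_length: "cox_equiv m u v \<Longrightarrow> cox_length m (cox_elem m u) \<le> length v"
  using cox_length_le[of m v] by (simp add: cox_elem_eq_iff[symmetric])

lemma cox_length_eq_0_iff: "cox_length m (cox_elem m u) = 0 \<longleftrightarrow> cox_equiv m u []"
proof
  assume "cox_length m (cox_elem m u) = 0"
  then show "cox_equiv m u []"
    by (metis cox_length_attained cox_sym length_0_conv)
next
  assume "cox_equiv m u []"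
  then show "cox_length m (cox_elem m u) = 0"
    using cox_length_le_length by fastforce
qed

lemma even_cox_length: "even (cox_length m (cox_elem m u)) = even (length u)"
  by (metis cox_length_attained cox_equiv_even_length)

text \<open>For \<open>k > 0\<close> the last letter is \<open>t\<close>, and larger
  \<open>k\<close> prolongs the word to the left, which suits splitting off suffixes.\<close>

fun alt_word :: "'s \<Rightarrow> 's \<Rightarrow> nat \<Rightarrow> 's list" where
  "alt_word s t 0 = []"
| "alt_word s t (Suc k) = alt_word t s k @ [t]"

lemma alt_word_Cons: "alt_word s t (Suc k) = (if even k then t else s) # alt_word s t k"
  by (induction k arbitrary: s t) auto

lemma alt_word_suffix: "j \<le> k \<Longrightarrow> \<exists>p. alt_word s t k = p @ alt_word s t j \<and> length p = k - j"
proof (induction k)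
  case (Suc k)
  show ?case
  proof (cases "j = Suc k")
    case False
    with Suc obtain p where "alt_word s t k = p @ alt_word s t j" "length p = k - j" by auto
    with Suc.prems False show ?thesis
      by (intro exI[of _ "(if even k then t else s) # p"]) (auto simp: alt_word_Cons Suc_diff_le
          simp del: alt_word.simps)
  qed auto
qed auto

lemma length_alt_word [simp]: "length (alt_word s t k) = k"
  by (induction k arbitrary: s t) auto

section \<open>The action of words by reflections\<close>

lemma word_action_Nil [simp]: "word_action m [] v = v"
  by (simp add: word_action_def)

lemma word_action_Cons [simp]:
  "word_action m (s # u) v = simple_reflection m s (word_action m u v)"
  by (simp add: word_action_def)

lemma word_action_append: "word_action m (u @ v) x = word_action m u (word_action m v x)"
  by (simp add: word_action_def)

lemma linear_cox_form: "linear (cox_form m v)"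
  by (rule linearI)
    (simp_all add: cox_form_def sum.distrib[symmetric] sum_distrib_left algebra_simps)

lemma linear_simple_reflection: "linear (simple_reflection m s)"
proof -
  interpret linear "cox_form m (axis s 1)" by (rule linear_cox_form)
  show ?thesis
    by (rule linearI) (simp_all add: simple_reflection_def add scale algebra_simps)
qed

lemma linear_word_action: "linear (word_action m u)"
proof (induction u)
  case (Cons s u)
  have "word_action m (s # u) = simple_reflection m s \<circ> word_action m u"
    by (auto simp: fun_eq_iff)
  with Cons show ?case
    using linear_compose linear_simple_reflection by metis
qed (simp add: word_action_def linear_id[unfolded id_def])

lemma cox_form_axis: "cox_form m (axis s 1) v = (\<Sum>t\<in>UNIV. v $ t * (- cos (pi / real (m s t))))"
proof -
  have "cox_form m (axis s 1) v
      = (\<Sum>r\<in>UNIV. if r = s then (\<Sum>t\<in>UNIV. v $ t * (- cos (pi / real (m s t)))) else 0)"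
    unfolding cox_form_def by (rule sum.cong) (auto simp: axis_def)
  then show ?thesis by simp
qed

lemma cox_form_axis_axis: "cox_form m (axis s 1) (axis t 1) = - cos (pi / real (m s t))"
proof -
  have "cox_form m (axis s 1) (axis t 1)
      = (\<Sum>r\<in>UNIV. if r = t then - cos (pi / real (m s r)) else 0)"
    unfolding cox_form_axis by (rule sum.cong) (auto simp: axis_def)
  then show ?thesis by simp
qed

lemma simple_reflection_nth:
  "simple_reflection m s v $ t
     = v $ t + (if t = s then \<Sum>r\<in>UNIV. 2 * v $ r * cos (pi / real (m s r)) else 0)"
  unfolding simple_reflection_def cox_form_axis
  by (simp add: axis_def sum_negf sum_distrib_left mult.assoc)

text \<open>For these labels \<open>2 * cos (pi / m s t)\<close> is 0, 1 or \<open>sqrt 2\<close>,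
  so questions about two nodes become finite computations.\<close>

locale coxeter_234 =
  fixes m :: "'s::finite \<Rightarrow> 's \<Rightarrow> nat"
  assumes diag [simp]: "m s s = 1"
    and m_sym: "m s t = m t s"
    and offdiag: "s \<noteq> t \<Longrightarrow> m s t \<in> {2, 3, 4}"
begin

abbreviation eqv (infix "\<doteq>" 50) where "u \<doteq> v \<equiv> cox_equiv m u v"
abbreviation len where "len u \<equiv> cox_length m (cox_elem m u)"
abbreviation act where "act \<equiv> word_action m"
abbreviation sroot :: "'s \<Rightarrow> real^'s" where "sroot s \<equiv> axis s 1"

definition bond :: "'s \<Rightarrow> 's \<Rightarrow> real" where "bond s t = 2 * cos (pi / real (m s t))"

lemma bond_sym: "bond s t = bond t s"
  by (simp add: bond_def m_sym)

lemma bond_cases: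
  assumes "s \<noteq> t"
  obtains "m s t = 2" "bond s t = 0" | "m s t = 3" "bond s t = 1"
    | "m s t = 4" "bond s t = sqrt 2"
  using offdiag[OF assms] by (auto simp: bond_def cos_60 cos_45)

text \<open>Each translate of the span of two simple roots is stable under both reflections, which
  act there by affine maps. Relations become identities in two coordinates.\<close>

lemma reflection_shift:
  "simple_reflection m s (v + x *\<^sub>R sroot s + y *\<^sub>R sroot t)
     = v + (bond s t * y - x - 2 * cox_form m (sroot s) v) *\<^sub>R sroot s + y *\<^sub>R sroot t"
proof -
  interpret linear "cox_form m (sroot s)" by (rule linear_cox_form)
  show ?thesis
    by (simp add: simple_reflection_def add scale cox_form_axis_axis bond_def vec_eq_iff algebra_simps)
qed

lemma reflection_shift':
  "simple_reflection m t (v + x *\<^sub>R sroot s + y *\<^sub>R sroot t)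
     = v + x *\<^sub>R sroot s + (bond s t * x - y - 2 * cox_form m (sroot t) v) *\<^sub>R sroot t"
  using reflection_shift[of t v y x s] by (simp add: add_ac bond_sym)

lemma reflection_reflection [simp]: "simple_reflection m s (simple_reflection m s v) = v"
  using reflection_shift[of s v 0 0 s] reflection_shift[of s v "- 2 * cox_form m (sroot s) v" 0 s]
  by simp

lemma reflection_root [simp]: "simple_reflection m s (sroot s) = - sroot s"
  by (simp add: simple_reflection_def cox_form_axis_axis scaleR_2)

lemma act_relation: "act (concat (replicate (m s t) [s, t])) v = v"
proof (cases "s = t")
  case False
  define p where "p x y = v + x *\<^sub>R sroot s + y *\<^sub>R sroot t" for x y
  have s: "simple_reflection m s (p x y) = p (bond s t * y - x - 2 * cox_form m (sroot s) v) y"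
    and t: "simple_reflection m t (p x y) = p x (bond s t * x - y - 2 * cox_form m (sroot t) v)"
    for x y
    unfolding p_def by (rule reflection_shift reflection_shift')+
  have sqrt2: "sqrt 2 * (sqrt 2 * x) = 2 * x" for x
    by (simp add: mult.assoc[symmetric])
  \<comment> \<open>The \<open>2 * m s t\<close> affine maps compose to fix the start because
    \<open>bond s t\<close> squares to 0, 1 or 2; the terms from \<open>v\<close> cancel.\<close>
  have "act (concat (replicate (m s t) [s, t])) (p 0 0) = p 0 0"
    by (cases rule: bond_cases[OF False])
      (simp_all add: s t sqrt2 eval_nat_numeral algebra_simps)
  then show ?thesis by (simp add: p_def)
qed auto

lemma act_cong: "u \<doteq> v \<Longrightarrow> act u = act v"
proof (induction rule: cox_equiv.induct)
  case (cox_relation u s t v)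
  show ?case by (simp add: fun_eq_iff word_action_append act_relation)
qed auto

lemma cancel: "u @ [s, s] @ v \<doteq> u @ v"
  using cox_relation[of m u s s v] by simp

lemma rev_append: "rev u @ u \<doteq> []" and append_rev: "u @ rev u \<doteq> []"
  using cox_equiv_rev_append[of m u] cox_equiv_rev_append[of m "rev u"] by simp_all

lemma act_rev_act [simp]: "act (rev u) (act u v) = v" "act u (act (rev u) v) = v"
  using act_cong[OF rev_append] act_cong[OF append_rev]
  by (simp_all add: fun_eq_iff word_action_append)

lemma act_root_nonzero: "act u (sroot s) \<noteq> 0"
proof
  assume "act u (sroot s) = 0"
  then have "sroot s = act (rev u) 0" by (metis act_rev_act(1))
  then show False by (simp add: linear_0[OF linear_word_action])
qed

lemma braid: assumes "s \<noteq> t" shows "alt_word s t (m s t) \<doteq> alt_word t s (m s t)"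
proof -
  let ?x = "alt_word s t (m s t)" and ?y = "alt_word t s (m s t)"
  \<comment> \<open>The relator is the inverse of one alternating word times the other.\<close>
  have "concat (replicate (m s t) [s, t]) = rev ?y @ ?x"
    using offdiag[OF assms] by (auto simp: eval_nat_numeral)
  then have "?y @ rev ?y @ ?x \<doteq> ?y"
    using cox_relation[of m ?y s t "[]"] by simp
  moreover have "?y @ rev ?y @ ?x \<doteq> ?x"
    using cox_equiv_append[OF append_rev cox_refl, of ?y ?x] by simp
  ultimately show ?thesis by (meson cox_sym cox_trans)
qed

section \<open>Length under products and inverses\<close>

lemma len_append: "len (u @ v) \<le> len u + len v"
proof -
  obtain u' v' where "length u' = len u" "u' \<doteq> u" "length v' = len v" "v' \<doteq> v"
    by (meson cox_length_attained)
  then show ?thesis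
    using cox_length_le_length[of m "u @ v" "u' @ v'"] cox_equiv_append[of m u' u v' v] cox_sym
    by fastforce
qed

lemma len_cong: "u \<doteq> v \<Longrightarrow> len u = len v"
  by (simp add: cox_elem_eq_iff[symmetric])

text \<open>A generator changes the length by at most one, and parity excludes equality.\<close>

lemma len_snoc: "len (u @ [s]) = len u + 1 \<or> len u = len (u @ [s]) + 1"
proof -
  have "len (u @ [s]) \<le> len u + 1" "len ((u @ [s]) @ [s]) \<le> len (u @ [s]) + 1"
    using len_append[of u "[s]"] len_append[of "u @ [s]" "[s]"] cox_length_le[of m "[s]"] by auto
  moreover have "len ((u @ [s]) @ [s]) = len u"
    using len_cong[OF cancel[of u s "[]"]] by simp
  moreover have "len (u @ [s]) \<noteq> len u"
    using even_cox_length[of m u] even_cox_length[of m "u @ [s]"] by auto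
  ultimately show ?thesis by linarith
qed

lemma len_rev: "len (rev u) = len u"
proof -
  have "len (rev u) \<le> len u" for u
  proof -
    obtain v where v: "length v = len u" "v \<doteq> u" by (rule cox_length_attained)
    have "rev u @ v @ rev v \<doteq> rev u"
      using cox_equiv_append[OF cox_refl append_rev] by fastforce
    moreover have "(rev u @ v) @ rev v \<doteq> rev v"
      using cox_equiv_append[OF cox_trans[OF cox_equiv_append[OF cox_refl v(2)] rev_append] cox_refl]
      by fastforce
    ultimately have "rev u \<doteq> rev v" by (metis append_assoc cox_sym cox_trans)
    then show ?thesis using cox_length_le_length v(1) by fastforce
  qed
  from this[of u] this[of "rev u"] show ?thesis by simp
qed

text \<open>The dihedral case: the coefficients are polynomials in \<open>bond s t\<close> whose
  values at 0, 1 and \<open>sqrt 2\<close> stay nonnegative up to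
  \<open>k = m s t - 1\<close>.\<close>

lemma alt_word_root_nonneg:
  assumes "s \<noteq> t" "k < m s t"
  obtains a b where "act (alt_word s t k) (sroot s) = a *\<^sub>R sroot s + b *\<^sub>R sroot t"
    "0 \<le> a" "0 \<le> b"
proof -
  define p where "p x y = x *\<^sub>R sroot s + y *\<^sub>R sroot t" for x y
  have s: "simple_reflection m s (p x y) = p (bond s t * y - x) y"
    and t: "simple_reflection m t (p x y) = p x (bond s t * x - y)" for x y
    using reflection_shift[of s 0 x y t] reflection_shift'[of t 0 x s y]
    by (simp_all add: p_def linear_0[OF linear_cox_form])
  have k: "k \<in> {0, 1, 2, 3}"
    using offdiag[OF assms(1)] assms(2) by auto
  have "\<exists>a b. act (alt_word s t k) (p 1 0) = p a b \<and> 0 \<le> a \<and> 0 \<le> b"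
  proof -
    have "act (alt_word s t 0) (p 1 0) = p 1 0"
      "act (alt_word s t 1) (p 1 0) = p 1 (bond s t)"
      "act (alt_word s t 2) (p 1 0) = p (bond s t * bond s t - 1) (bond s t)"
      "act (alt_word s t 3) (p 1 0)
         = p (bond s t * bond s t - 1) (bond s t * (bond s t * bond s t - 1) - bond s t)"
      by (simp_all add: s t eval_nat_numeral)
    moreover have "\<exists>a' b'. p a b = p a' b' \<and> 0 \<le> a' \<and> 0 \<le> b'" if "0 \<le> a" "0 \<le> b" for a b
      using that by blast
    ultimately show ?thesis
      using k by (cases rule: bond_cases[OF assms(1)]) (use assms(2) in auto)
  qed
  then show ?thesis using that by (auto simp: p_def)
qed

text \<open>
  The decomposition of \<open>u\<close> takes off a longest possible alternating suffix in \<open>s\<close> and \<open>t\<close>. What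
  remains in front of it sends both \<open>sroot s\<close> and \<open>sroot t\<close> to positive roots, by induction.
\<close>

lemma act_root_nonneg: "len u < len (u @ [s]) \<Longrightarrow> 0 \<le> act u (sroot s)"
proof (induction "len u" arbitrary: u s rule: less_induct)
  case less
  obtain w where w: "length w = len u" "w \<doteq> u" by (rule cox_length_attained)
  show ?case
  proof (cases "w = []")
    case True
    then have "act u = act []" using act_cong[OF w(2)] by simp
    then show ?thesis by (simp add: less_eq_vec_def axis_def)
  next
    case False
    define t where "t = last w"
    have w_eq: "w = butlast w @ [t]" using False by (simp add: t_def)
    \<comment> \<open>No shortest word of \<open>u\<close> ends in \<open>s\<close>: deleting that
      letter would make \<open>u @ [s]\<close> shorter than \<open>u\<close>.\<close>
    have not_s: False if "length v + 1 = len u" "v @ [s] \<doteq> u" for v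
    proof -
      have "v @ [s, s] \<doteq> u @ [s]" using cox_equiv_append[OF that(2) cox_refl, of "[s]"] by simp
      then have "u @ [s] \<doteq> v" using cancel[of v s "[]"] by (metis append_Nil2 cox_sym cox_trans)
      then show False using cox_length_le_length[of m "u @ [s]" v] that(1) less.prems by simp
    qed
    have "s \<noteq> t"
      using not_s[of "butlast w"] w w_eq False by (metis append_butlast_last_id length_append_singleton
          Suc_eq_plus1)
    \<comment> \<open>Some shortest word of \<open>u\<close> ends in the alternating word of length
      \<open>k\<close>.\<close>
    define P where "P k \<longleftrightarrow> (\<exists>v. length v + k = len u \<and> v @ alt_word s t k \<doteq> u)" for k
    have P1: "P 1"
      unfolding P_def using w w_eq by (intro exI[of _ "butlast w"])
        (metis One_nat_def alt_word.simps append_self_conv2 length_append length_Cons list.size(3))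
    have Pb: "\<forall>k. P k \<longrightarrow> k \<le> len u" unfolding P_def by auto
    define k where "k = Greatest P"
    have Pk: "P k" unfolding k_def using GreatestI_nat[of P] P1 Pb by blast
    have kmax: "\<not> P (Suc k)" unfolding k_def using Greatest_le_nat[of P "Suc k"] Pb
      by (metis k_def not_less_eq_eq order_refl)
    have "k \<ge> 1" unfolding k_def using Greatest_le_nat[of P 1] P1 Pb by blast
    from Pk obtain v where v: "length v + k = len u" "v @ alt_word s t k \<doteq> u"
      unfolding P_def by blast
    \<comment> \<open>Otherwise the braid relation would produce a shortest word of \<open>u\<close>
      ending in \<open>s\<close>.\<close>
    have "k < m s t"
    proof (rule ccontr)
      assume "\<not> k < m s t"
      then obtain p where p: "alt_word s t k = p @ alt_word s t (m s t)" "length p = k - m s t"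
        using alt_word_suffix[of "m s t" k s t] by auto
      obtain j where j: "m s t = Suc j" using offdiag[OF \<open>s \<noteq> t\<close>] by (cases "m s t") auto
      have "v @ p @ alt_word t s (m s t) \<doteq> v @ p @ alt_word s t (m s t)"
        using cox_equiv_context[OF cox_sym[OF braid[OF \<open>s \<noteq> t\<close>]], of "v @ p" "[]"] by simp
      then have "v @ p @ alt_word t s (m s t) \<doteq> u" using v(2) p(1) cox_trans by metis
      then show False
        using not_s[of "v @ p @ alt_word s t j"] v(1) p(2) j \<open>\<not> k < m s t\<close> by simp
    qed
    have len_v: "len v = length v"
    proof (rule antisym)
      have "len u \<le> len v + len (alt_word s t k)"
        using len_append[of v "alt_word s t k"] len_cong[OF v(2)] by simp
      then show "length v \<le> len v"
        using v(1) cox_length_le[of m "alt_word s t k"] by simp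
    qed (rule cox_length_le)
    \<comment> \<open>If \<open>x\<close> shortened \<open>v\<close>, a shortest word of
      \<open>v\<close> would end in \<open>x\<close>. This letter either prolongs the alternating
      suffix, against maximality of \<open>k\<close>, or cancels its first letter and leaves a word
      for \<open>u\<close> with two letters fewer.\<close>
    have up: "len v < len (v @ [x])" if "x \<in> {s, t}" for x
    proof (rule ccontr)
      assume "\<not> ?thesis"
      then have down: "len v = len (v @ [x]) + 1" using len_snoc[of v x] by auto
      then obtain v' where v': "length v' + 1 = length v" "v' \<doteq> v @ [x]"
        using len_v cox_length_attained by metis
      have vx: "v' @ [x] \<doteq> v"
        using cox_trans[OF cox_equiv_append[OF v'(2) cox_refl, of "[x]"]] cancel[of v x "[]"]
        by simp
      show False
      proof (cases "x = (if even k then t else s)")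
        case True
        have "v' @ alt_word s t (Suc k) \<doteq> u"
          using cox_trans[OF cox_equiv_append[OF vx cox_refl] v(2)] True
          by (simp add: alt_word_Cons del: alt_word.simps)
        then show False using kmax v(1) v'(1) unfolding P_def
          by (metis add.assoc add_Suc_right plus_1_eq_Suc add.commute)
      next
        case False
        obtain j where j: "k = Suc j" using \<open>k \<ge> 1\<close> by (cases k) auto
        with False that have alt: "alt_word s t k = x # alt_word s t j"
          by (auto simp: alt_word_Cons simp del: alt_word.simps)
        have "v' @ alt_word s t j \<doteq> (v @ [x]) @ alt_word s t j"
          by (rule cox_equiv_append[OF v'(2) cox_refl])
        then have "v' @ alt_word s t j \<doteq> u" using cox_trans v(2) alt by fastforce
        then show False
          using cox_length_le_length[OF cox_sym, of m "v' @ alt_word s t j" u] v(1) v'(1) j by simp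
      qed
    qed
    have "len v < len u" using len_v v(1) \<open>k \<ge> 1\<close> by simp
    from less.hyps[OF this up] have pos: "0 \<le> act v (sroot s)" "0 \<le> act v (sroot t)"
      by simp_all
    obtain a b where ab: "act (alt_word s t k) (sroot s) = a *\<^sub>R sroot s + b *\<^sub>R sroot t"
      "0 \<le> a" "0 \<le> b"
      using alt_word_root_nonneg[OF \<open>s \<noteq> t\<close> \<open>k < m s t\<close>] .
    have "act u (sroot s) = act v (a *\<^sub>R sroot s + b *\<^sub>R sroot t)"
      using act_cong[OF v(2)] ab(1) by (metis word_action_append)
    also have "\<dots> = a *\<^sub>R act v (sroot s) + b *\<^sub>R act v (sroot t)"
      by (simp add: linear_add[OF linear_word_action] linear_scale[OF linear_word_action])
    also have "\<dots> \<ge> 0"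
      using pos ab(2,3) by (simp add: less_eq_vec_def)
    finally show ?thesis .
  qed
qed

section \<open>Descents and faithfulness\<close>

lemma act_snoc_root: "act (u @ [s]) (sroot s) = - act u (sroot s)"
  by (simp add: word_action_append linear_neg[OF linear_word_action])

lemma act_root_nonpos: "len (u @ [s]) < len u \<Longrightarrow> act u (sroot s) \<le> 0"
  using act_root_nonneg[of "u @ [s]" s] len_cong[OF cancel[of u s "[]"]]
  by (simp add: act_snoc_root)

lemma len_snoc_iff: "len (u @ [s]) = len u + 1 \<longleftrightarrow> 0 \<le> act u (sroot s)"
  and len_snoc_iff': "len u = len (u @ [s]) + 1 \<longleftrightarrow> act u (sroot s) \<le> 0"
proof -
  have "\<not> (0 \<le> act u (sroot s) \<and> act u (sroot s) \<le> 0)"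
    using act_root_nonzero[of u s] by (blast intro: order.antisym)
  then show "len (u @ [s]) = len u + 1 \<longleftrightarrow> 0 \<le> act u (sroot s)"
    and "len u = len (u @ [s]) + 1 \<longleftrightarrow> act u (sroot s) \<le> 0"
    using len_snoc[of u s] act_root_nonneg[of u s] act_root_nonpos[of u s] by linarith+
qed

lemma root_signs: "0 \<le> act u (sroot s) \<or> act u (sroot s) \<le> 0"
  using len_snoc len_snoc_iff len_snoc_iff' by blast

text \<open>The last letter of a nonempty shortest word is a descent, so its simple root is sent to
  a nonpositive vector.\<close>

lemma equiv_Nil_if_roots_nonneg:
  assumes "\<And>s. 0 \<le> act u (sroot s)" shows "u \<doteq> []"
proof -
  obtain w where w: "length w = len u" "w \<doteq> u" by (rule cox_length_attained)
  have "w = []"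
  proof (rule ccontr)
    assume "w \<noteq> []"
    then have w_eq: "w = butlast w @ [last w]" by simp
    have "len (w @ [last w]) \<le> length (butlast w)"
      using cox_length_le_length[OF cancel[of "butlast w" "last w" "[]"]] w_eq
      by (metis append.assoc append_Cons append_Nil append_Nil2)
    moreover have "len (w @ [last w]) = len w + 1"
      using assms act_cong[OF w(2)] len_snoc_iff[of w "last w"] by simp
    ultimately show False
      using w len_cong[OF w(2)] \<open>w \<noteq> []\<close> by simp
  qed
  with w(2) show ?thesis using cox_sym by blast
qed

lemma equiv_if_rev_append: assumes "rev v @ u \<doteq> []" shows "u \<doteq> v"
proof -
  have "v @ rev v @ u \<doteq> u" "v @ rev v @ u \<doteq> v"
    using cox_equiv_append[OF append_rev cox_refl, of v u] cox_equiv_append[OF cox_refl assms, of v]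
    by simp_all
  then show ?thesis by (meson cox_sym cox_trans)
qed

text \<open>If both words act alike, \<open>rev v @ u\<close> fixes every simple root and thus
  represents the identity.\<close>

lemma act_faithful: "act u = act v \<longleftrightarrow> u \<doteq> v"
proof
  assume eq: "act u = act v"
  have "rev v @ u \<doteq> []"
    by (rule equiv_Nil_if_roots_nonneg)
      (simp add: word_action_append eq less_eq_vec_def axis_def)
  then show "u \<doteq> v" by (rule equiv_if_rev_append)
qed (rule act_cong)

section \<open>Parabolic subgroups and their longest elements\<close>

lemma act_outside: "set u \<subseteq> I \<Longrightarrow> t \<notin> I \<Longrightarrow> act u v $ t = v $ t"
  by (induction u) (auto simp: simple_reflection_def axis_def)

lemma act_eq_sum: "act w v = (\<Sum>s\<in>UNIV. (v $ s) *\<^sub>R act w (sroot s))"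
proof -
  have "act w v = act w (\<Sum>s\<in>UNIV. (v $ s) *\<^sub>R sroot s)"
    using basis_expansion[of v] by (simp add: scalar_mult_eq_scaleR)
  then show ?thesis
    by (simp add: linear_sum[OF linear_word_action] linear_scale[OF linear_word_action])
qed

lemma act_nonpos:
  assumes neg: "\<And>s. s \<in> I \<Longrightarrow> act w (sroot s) \<le> 0"
    and v: "0 \<le> v" "\<And>t. t \<notin> I \<Longrightarrow> v $ t = 0"
  shows "act w v \<le> 0"
proof -
  have "v $ s * act w (sroot s) $ t \<le> 0" for s t
    using neg[of s] v by (cases "s \<in> I") (auto simp: less_eq_vec_def intro: mult_nonneg_nonpos)
  then show ?thesis
    by (subst act_eq_sum) (simp add: less_eq_vec_def sum_nonpos)
qed

text \<open>A test by evaluation on simple roots, in place of comparing lengths over the whole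
  parabolic subgroup.\<close>

definition longest_word :: "'s set \<Rightarrow> 's list \<Rightarrow> bool" where
  "longest_word I w \<longleftrightarrow> set w \<subseteq> I \<and> (\<forall>s\<in>I. act w (sroot s) \<le> 0)"

text \<open>A letter \<open>s\<close> lengthens \<open>y\<close> exactly if it shortens
  \<open>w @ y\<close>: the image of \<open>sroot s\<close> under \<open>y\<close> lies in the span
  of \<open>I\<close> and has a sign, which \<open>w\<close> reverses.\<close>

lemma len_longest_word_append:
  assumes w: "longest_word I w" and y: "set y \<subseteq> I"
  shows "len (w @ y) + len y = len w"
  using y
proof (induction y rule: rev_induct)
  case Nil
  have "len [] = 0" by (simp add: cox_length_eq_0_iff cox_refl)
  then show ?case by simp
next
  case (snoc s y)
  have s: "s \<in> I" and IH: "len (w @ y) + len y = len w" using snoc by auto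
  have neg: "act w (sroot t) \<le> 0" if "t \<in> I" for t using w that by (simp add: longest_word_def)
  let ?x = "act y (sroot s)"
  have supp: "?x $ t = 0" if "t \<notin> I" for t
    using act_outside[of y I t] snoc.prems s that by (auto simp: axis_def)
  have act: "act (w @ y) (sroot s) = act w ?x" by (simp add: word_action_append)
  from root_signs[of y s] show ?case
  proof
    assume pos: "0 \<le> ?x"
    then have "act (w @ y) (sroot s) \<le> 0"
      unfolding act using act_nonpos[of I w ?x] neg supp by blast
    then show ?thesis
      using pos IH len_snoc_iff[of y s] len_snoc_iff'[of "w @ y" s] by simp
  next
    assume le: "?x \<le> 0"
    then have "act w (- ?x) \<le> 0"
      using act_nonpos[of I w "- ?x"] neg supp by simp
    then have "0 \<le> act (w @ y) (sroot s)"
      by (simp add: act linear_neg[OF linear_word_action])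
    then show ?thesis
      using le IH len_snoc_iff'[of y s] len_snoc_iff[of "w @ y" s] by simp
  qed
qed

lemma one_elem: "\<one>\<^bsub>coxeter_group m\<^esub> = cox_elem m []"
  by (simp add: coxeter_group_def)

lemma carrier_elem: "carrier (coxeter_group m) = range (cox_elem m)"
  by (simp add: coxeter_group_def)

lemma is_group: "group (coxeter_group m)"
  by (rule group_coxeter_group) simp

lemma inv_elem: "inv\<^bsub>coxeter_group m\<^esub> cox_elem m u = cox_elem m (rev u)"
  by (rule group.inv_equality[OF is_group], unfold coxeter_group_mult one_elem carrier_elem)
    (auto simp: cox_elem_eq_iff rev_append intro: rangeI)

lemma parabolic_eq: "parabolic m I = cox_elem m ` lists I"
proof
  show "parabolic m I \<subseteq> cox_elem m ` lists I"
  proof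
    fix x assume "x \<in> parabolic m I"
    then show "x \<in> cox_elem m ` lists I"
      unfolding parabolic_def
    proof induction
      case one
      then show ?case by (auto simp: one_elem)
    next
      case (incl h)
      then obtain s where "s \<in> I" "h = cox_elem m [s]" by (auto simp: simple_gen_def)
      then show ?case by auto
    next
      case (inv h)
      then obtain s where "s \<in> I" "h = cox_elem m [s]" by (auto simp: simple_gen_def)
      then show ?case by (auto simp: inv_elem)
    next
      case (eng h1 h2)
      then show ?case by (force simp: coxeter_group_mult)
    qed
  qed
  have "cox_elem m u \<in> parabolic m I" if "set u \<subseteq> I" for u
    using that
  proof (induction u)
    case Nil
    show ?case unfolding parabolic_def one_elem[symmetric] by (rule generate.one)
  next
    case (Cons s u)
    have "cox_elem m [s] \<in> parabolic m I"
      unfolding parabolic_def by (rule generate.incl) (use Cons.prems in \<open>auto simp: simple_gen_def\<close>)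
    with Cons show ?case
      using generate.eng[of "cox_elem m [s]" "coxeter_group m" _ "cox_elem m u"]
      by (simp add: parabolic_def coxeter_group_mult)
  qed
  then show "cox_elem m ` lists I \<subseteq> parabolic m I" by (auto simp: lists_eq_set)
qed

lemma longest_elem_eq:
  assumes w: "longest_word I w"
  shows "longest_elem m I = cox_elem m w"
proof -
  have le: "len y \<le> len w" if "set y \<subseteq> I" for y
    using len_longest_word_append[OF w that] by simp
  \<comment> \<open>Such a \<open>y\<close> gives \<open>w @ y\<close> length 0, so it is the
    inverse of \<open>w\<close>. Applied to \<open>w\<close> itself, this shows that
    \<open>w\<close> is its own inverse.\<close>
  have uniq: "y \<doteq> rev w" if "set y \<subseteq> I" "len w \<le> len y" for y
  proof -
    have "w @ y \<doteq> []"
      using len_longest_word_append[OF w that(1)] that(2) by (simp add: cox_length_eq_0_iff[symmetric])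
    then show ?thesis using equiv_if_rev_append[of "rev w" y] by simp
  qed
  have sub: "set w \<subseteq> I" using w by (simp add: longest_word_def)
  show ?thesis
    unfolding longest_elem_def parabolic_eq
  proof (rule the_equality)
    show "cox_elem m w \<in> cox_elem m ` lists I \<and> (\<forall>y\<in>cox_elem m ` lists I. cox_length m y \<le> len w)"
      using sub le by (auto simp: lists_eq_set)
    fix x
    assume x: "x \<in> cox_elem m ` lists I \<and> (\<forall>y\<in>cox_elem m ` lists I. cox_length m y \<le> cox_length m x)"
    then obtain y where y: "set y \<subseteq> I" "x = cox_elem m y" by (auto simp: lists_eq_set)
    with x sub have "len w \<le> len y" by (auto simp: lists_eq_set)
    then have "y \<doteq> rev w" "w \<doteq> rev w" using uniq y sub by simp_all
    then show "x = cox_elem m w" using y(2) by (metis cox_elem_eq_iff)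
  qed
qed

section \<open>Involutions\<close>

text \<open>
  Conjugating an involution by a descent \<open>s\<close> that it does not negate makes it shorter.
\<close>

lemma involution_conj_negating:
  assumes "u @ u \<doteq> []"
  shows "\<exists>g v. g @ v @ rev g \<doteq> u \<and> v @ v \<doteq> []
    \<and> (\<forall>s. 0 \<le> act v (sroot s) \<or> act v (sroot s) = - sroot s)"
  using assms
proof (induction "len u" arbitrary: u rule: less_induct)
  case less
  have act2: "act u (act u x) = x" for x
    using act_cong[OF less.prems] by (simp add: fun_eq_iff word_action_append)
  have rev_u: "rev u \<doteq> u"
    using cox_sym[OF equiv_if_rev_append[of "rev u" u]] less.prems by simp
  show ?case
  proof (cases "\<forall>s. 0 \<le> act u (sroot s) \<or> act u (sroot s) = - sroot s")
    case True
    then show ?thesis using less.prems by (intro exI[of _ "[]"] exI[of _ u]) (simp add: cox_refl)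
  next
    case False
    then obtain s where s: "\<not> 0 \<le> act u (sroot s)" "act u (sroot s) \<noteq> - sroot s" by blast
    define x where "x = act u (sroot s)"
    have x: "x \<le> 0" using root_signs s(1) x_def by blast
    have conj_root: "act (s # rev u) (sroot s) = simple_reflection m s x"
      using act_cong[OF rev_u] by (simp add: x_def)
    \<comment> \<open>Reflecting in \<open>s\<close> changes only coordinate \<open>s\<close>. If it
      made the nonpositive \<open>x\<close> nonnegative, \<open>x\<close> would be a multiple of
      \<open>sroot s\<close>; as \<open>u\<close> is an involution the factor would be -1, which the
      choice of \<open>s\<close> excludes.\<close>
    have "\<not> 0 \<le> act (s # rev u) (sroot s)"
    proof
      assume "0 \<le> act (s # rev u) (sroot s)"
      then have "0 \<le> simple_reflection m s x $ t" for t
        by (simp only: conj_root) (simp add: less_eq_vec_def)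
      moreover have "simple_reflection m s x $ t = x $ t" if "t \<noteq> s" for t
        using that by (simp add: simple_reflection_def axis_def)
      ultimately have "x $ t = 0" if "t \<noteq> s" for t
        using x that by (metis less_eq_vec_def order_antisym zero_index)
      then have xs: "x = (x $ s) *\<^sub>R sroot s" by (auto simp: vec_eq_iff axis_def)
      then have "sroot s = (x $ s) *\<^sub>R x"
        using act2[of "sroot s"] linear_scale[OF linear_word_action, of m u "x $ s" "sroot s"]
        by (metis x_def)
      then have "1 = x $ s * x $ s" by (metis axis_nth real_scaleR_def vector_scaleR_component)
      moreover have "x $ s \<le> 0" using x by (simp add: less_eq_vec_def)
      ultimately have "x $ s = - 1" using square_eq_1_iff[of "x $ s"] by auto
      with xs s(2) show False by (simp add: x_def)
    qed
    \<comment> \<open>Since inversion preserves length, the descent of \<open>u\<close> and this one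
      together make the conjugate by \<open>s\<close> shorter by two.\<close>
    then have "len (s # rev u) = len ((s # rev u) @ [s]) + 1"
      using root_signs len_snoc_iff' by blast
    moreover have "len u = len (u @ [s]) + 1" using x len_snoc_iff'[of u s] by (simp add: x_def)
    moreover have "len (u @ [s]) = len (s # rev u)" using len_rev[of "u @ [s]"] by simp
    moreover have "len (s # u @ [s]) = len ((s # rev u) @ [s])"
      using len_rev[of "s # u @ [s]"] by simp
    ultimately have short: "len (s # u @ [s]) < len u" by linarith
    have "(s # u @ [s]) @ (s # u @ [s]) \<doteq> []"
      unfolding act_faithful[symmetric] by (simp add: fun_eq_iff word_action_append act2)
    from less.hyps[OF short this] obtain g v where gv: "g @ v @ rev g \<doteq> s # u @ [s]" "v @ v \<doteq> []"
      "\<forall>s. 0 \<le> act v (sroot s) \<or> act v (sroot s) = - sroot s"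
      by blast
    have "(s # g) @ v @ rev (s # g) \<doteq> u"
      using act_cong[OF gv(1)] unfolding act_faithful[symmetric]
      by (auto simp: fun_eq_iff word_action_append)
    with gv(2,3) show ?thesis by blast
  qed
qed

text \<open>As \<open>v\<close> is -1 on the span of \<open>I\<close>, it undoes the sign change by
  \<open>w\<close> there; \<open>v @ w\<close> keeps all simple roots nonnegative and so is the
  identity.\<close>

lemma negating_involution_eq_longest:
  assumes vv: "v @ v \<doteq> []"
    and neg: "\<And>s. s \<in> I \<Longrightarrow> act v (sroot s) = - sroot s"
    and pos: "\<And>s. s \<notin> I \<Longrightarrow> 0 \<le> act v (sroot s)"
    and w: "longest_word I w"
  shows "v \<doteq> w"
proof -
  have act2: "act v (act v x) = x" for x
    using act_cong[OF vv] by (simp add: fun_eq_iff word_action_append)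
  have span: "act v x = - x" if "\<And>t. t \<notin> I \<Longrightarrow> x $ t = 0" for x
  proof -
    have "(x $ s) *\<^sub>R act v (sroot s) = - ((x $ s) *\<^sub>R sroot s)" for s
      using that[of s] neg[of s] by (cases "s \<in> I") auto
    then show ?thesis
      using act_eq_sum[of v x] basis_expansion[of x]
      by (simp add: sum_negf scalar_mult_eq_scaleR)
  qed
  have w_out: "act w x $ t = x $ t" if "t \<notin> I" for x t
    using w act_outside that by (auto simp: longest_word_def)
  have "0 \<le> act (v @ w) (sroot s)" for s
  proof (cases "s \<in> I")
    case True
    then have "act v (act w (sroot s)) = - act w (sroot s)"
      using w_out by (intro span) (auto simp: axis_def)
    then show ?thesis using w True by (simp add: word_action_append longest_word_def)
  next
    case False
    \<comment> \<open>\<open>w\<close> moves \<open>sroot s\<close> by a vector in the span of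
      \<open>I\<close>, which \<open>v\<close> negates.\<close>
    define q where "q = act w (sroot s) - sroot s"
    have q: "q $ t = 0" if "t \<notin> I" for t using w_out that by (simp add: q_def)
    have "act w (sroot s) = sroot s + q" by (simp add: q_def)
    then have eq: "act (v @ w) (sroot s) = act v (sroot s) - q"
      using span[of q] q by (simp add: word_action_append linear_add[OF linear_word_action])
    \<comment> \<open>Otherwise \<open>act v (sroot s)\<close> would lie in the span of
      \<open>I\<close>, where \<open>v\<close> is -1; applying \<open>v\<close> again would put
      \<open>sroot s\<close> in that span too.\<close>
    have "\<not> act (v @ w) (sroot s) \<le> 0"
    proof
      assume le: "act (v @ w) (sroot s) \<le> 0"
      have "act v (sroot s) $ t = 0" if "t \<notin> I" for t
        using le pos[OF False] q[OF that] unfolding eq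
        by (auto simp: less_eq_vec_def dest!: spec[of _ t])
      then have "sroot s = - act v (sroot s)" and "act v (sroot s) $ s = 0"
        using span[of "act v (sroot s)"] act2 False by simp_all
      then show False by (metis axis_nth neg_equal_0_iff_equal uminus_vec_def vec_lambda_beta zero_neq_one)
    qed
    then show ?thesis using root_signs by blast
  qed
  then have "act (v @ w) = act []"
    using act_cong equiv_Nil_if_roots_nonneg by blast
  then have "act v (act v (act w x)) = act v x" for x
    by (simp add: fun_eq_iff word_action_append)
  then show ?thesis
    unfolding act_faithful[symmetric] by (simp add: act2 fun_eq_iff)
qed

text \<open>\<open>w\<close> stays a variable so that a concrete longest word can be inserted once
  \<open>I\<close> is known.\<close>

lemma involution_conj_longest:
  assumes "u @ u \<doteq> []"
  obtains I g where "\<forall>w. longest_word I w \<longrightarrow>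
    g @ w @ rev g \<doteq> u \<and> (\<forall>s\<in>I. act w (sroot s) = - sroot s)"
proof -
  obtain g v where v: "g @ v @ rev g \<doteq> u" "v @ v \<doteq> []"
    "\<forall>s. 0 \<le> act v (sroot s) \<or> act v (sroot s) = - sroot s"
    using involution_conj_negating[OF assms] by blast
  define I where "I = {s. act v (sroot s) = - sroot s}"
  have "g @ w @ rev g \<doteq> u \<and> (\<forall>s\<in>I. act w (sroot s) = - sroot s)" if "longest_word I w" for w
  proof -
    have vw: "v \<doteq> w"
      using v(2,3) that by (intro negating_involution_eq_longest[of v I w]) (auto simp: I_def)
    then have "g @ w @ rev g \<doteq> u"
      using cox_equiv_context[of m v w g "rev g"] v(1) by (meson cox_sym cox_trans)
    with act_cong[OF vw] show ?thesis by (auto simp: I_def)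
  qed
  with that show ?thesis by blast
qed

section \<open>Conjugacy classes in terms of words\<close>

lemma conj_class_mem_iff:
  "cox_elem m u \<in> conj_class (coxeter_group m) (cox_elem m v) \<longleftrightarrow> (\<exists>g. g @ v @ rev g \<doteq> u)"
proof -
  have "conj_class (coxeter_group m) (cox_elem m v) = range (\<lambda>g. cox_elem m (g @ v @ rev g))"
    by (force simp: conj_class_def carrier_elem inv_elem coxeter_group_mult)
  then show ?thesis by (auto simp: image_iff cox_elem_eq_iff intro: cox_sym)
qed

end

lemma (in group) conj_class_eq:
  assumes "x \<in> carrier G" "y \<in> conj_class G x"
  shows "conj_class G y = conj_class G x"
proof -
  have sub: "conj_class G y \<subseteq> conj_class G x" if "x \<in> carrier G" "y \<in> conj_class G x" for x y
  proof
    fix z assume "z \<in> conj_class G y"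
    then obtain g h where "g \<in> carrier G" "h \<in> carrier G" "z = g \<otimes> y \<otimes> inv g" "y = h \<otimes> x \<otimes> inv h"
      using \<open>y \<in> conj_class G x\<close> by (auto simp: conj_class_def)
    then have "z = (g \<otimes> h) \<otimes> x \<otimes> inv (g \<otimes> h)" "g \<otimes> h \<in> carrier G"
      using \<open>x \<in> carrier G\<close> by (simp_all add: m_assoc inv_mult_group)
    then show "z \<in> conj_class G x" by (auto simp: conj_class_def)
  qed
  obtain h where h: "h \<in> carrier G" "y = h \<otimes> x \<otimes> inv h"
    using assms(2) by (auto simp: conj_class_def)
  then have "x = inv h \<otimes> y \<otimes> inv (inv h)" "y \<in> carrier G"
    using assms(1) by (simp_all add: m_assoc inv_solve_left)
  then have "x \<in> conj_class G y" using h(1) inv_closed unfolding conj_class_def by blast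
  then show ?thesis using sub assms \<open>y \<in> carrier G\<close> by blast
qed

section \<open>Type F4\<close>

interpretation F4: coxeter_234 F4
  by unfold_locales (auto simp: F4_def insert_commute)

text \<open>Stretching the simple roots of nodes 3 and 4 by \<open>sqrt 2\<close> gives the
  crystallographic root system with its integral Cartan matrix; positive factors leave signs
  unchanged.\<close>

definition F4_vec :: "real \<Rightarrow> real \<Rightarrow> real \<Rightarrow> real \<Rightarrow> real^4" where
  "F4_vec a b c d =
     (\<chi> s. if s = 1 then a else if s = 2 then b else if s = 3 then sqrt 2 * c else sqrt 2 * d)"

lemma F4_vec_nth [simp]:
  "F4_vec a b c d $ 1 = a" "F4_vec a b c d $ 2 = b"
  "F4_vec a b c d $ 3 = sqrt 2 * c" "F4_vec a b c d $ 4 = sqrt 2 * d"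
  by (simp_all add: F4_vec_def)

lemma F4_vec_cases: obtains a b c d where "v = F4_vec a b c d"
proof
  show "v = F4_vec (v $ 1) (v $ 2) (v $ 3 / sqrt 2) (v $ 4 / sqrt 2)"
    by (simp add: vec_eq_iff forall_4)
qed

text \<open>In these coordinates the simple reflections are integral.\<close>

lemma reflection_F4_vec [simp]:
  "simple_reflection F4 1 (F4_vec a b c d) = F4_vec (b - a) b c d"
  "simple_reflection F4 2 (F4_vec a b c d) = F4_vec a (a + 2 * c - b) c d"
  "simple_reflection F4 3 (F4_vec a b c d) = F4_vec a b (b + d - c) d"
  "simple_reflection F4 4 (F4_vec a b c d) = F4_vec a b c (c - d)"
  by (simp_all add: vec_eq_iff forall_4 simple_reflection_nth sum_4 F4_def cos_60 cos_45
      doubleton_eq_iff algebra_simps)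

lemma axis_eq_F4_vec:
  "axis 1 1 = F4_vec 1 0 0 0" "axis 2 1 = F4_vec 0 1 0 0"
  "axis 3 1 = (1 / sqrt 2) *\<^sub>R F4_vec 0 0 1 0" "axis 4 1 = (1 / sqrt 2) *\<^sub>R F4_vec 0 0 0 1"
  by (simp_all add: vec_eq_iff forall_4 axis_def)

lemma F4_act_axis:
  "word_action F4 w (axis 1 1) = word_action F4 w (F4_vec 1 0 0 0)"
  "word_action F4 w (axis 2 1) = word_action F4 w (F4_vec 0 1 0 0)"
  "word_action F4 w (axis 3 1) = (1 / sqrt 2) *\<^sub>R word_action F4 w (F4_vec 0 0 1 0)"
  "word_action F4 w (axis 4 1) = (1 / sqrt 2) *\<^sub>R word_action F4 w (F4_vec 0 0 0 1)"
  by (simp_all add: axis_eq_F4_vec linear_scale[OF linear_word_action])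

lemma F4_vec_le_0:
  "F4_vec a b c d \<le> 0 \<longleftrightarrow> a \<le> 0 \<and> b \<le> 0 \<and> c \<le> 0 \<and> d \<le> 0"
  "(1 / sqrt 2) *\<^sub>R F4_vec a b c d \<le> 0 \<longleftrightarrow> a \<le> 0 \<and> b \<le> 0 \<and> c \<le> 0 \<and> d \<le> 0"
  by (auto simp: less_eq_vec_def forall_4 mult_le_0_iff divide_le_0_iff)

text \<open>By faithfulness, one symbolic evaluation on a general vector proves equality in the
  group.\<close>

lemma F4_equivI:
  assumes "\<And>a b c d. word_action F4 u (F4_vec a b c d) = word_action F4 v (F4_vec a b c d)"
  shows "cox_equiv F4 u v"
  unfolding F4.act_faithful[symmetric] using assms by (metis F4_vec_cases ext)

text \<open>Coxeter elements raised to half the Coxeter number, which act as \<open>-1\<close>.\<close>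

abbreviation F4_w123 :: "4 list" where
  "F4_w123 \<equiv> [1, 2, 3, 1, 2, 3, 1, 2, 3]"

abbreviation F4_w234 :: "4 list" where
  "F4_w234 \<equiv> [2, 3, 4, 2, 3, 4, 2, 3, 4]"

abbreviation F4_w1234 :: "4 list" where
  "F4_w1234 \<equiv> [1, 2, 3, 4, 1, 2, 3, 4, 1, 2, 3, 4, 1, 2, 3, 4, 1, 2, 3, 4, 1, 2, 3, 4]"

text \<open>A table for all sixteen subsets; a disconnected subset gets the concatenated words of
  its components.\<close>

lemma F4_longest_word:
  "F4.longest_word {} []"
  "F4.longest_word {1} [1]"
  "F4.longest_word {2} [2]"
  "F4.longest_word {3} [3]"
  "F4.longest_word {4} [4]"
  "F4.longest_word {1, 3} [1, 3]"
  "F4.longest_word {1, 4} [1, 4]"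
  "F4.longest_word {2, 4} [2, 4]"
  "F4.longest_word {2, 3} [2, 3, 2, 3]"
  "F4.longest_word {1, 2} [1, 2, 1]"
  "F4.longest_word {3, 4} [3, 4, 3]"
  "F4.longest_word {1, 2, 4} [1, 2, 1, 4]"
  "F4.longest_word {1, 3, 4} [1, 3, 4, 3]"
  "F4.longest_word {1, 2, 3} F4_w123"
  "F4.longest_word {2, 3, 4} F4_w234"
  "F4.longest_word {1, 2, 3, 4} F4_w1234"
  unfolding F4.longest_word_def ball_simps F4_act_axis by (simp_all add: F4_vec_le_0)

text \<open>These subsets have a component of type A2, whose longest element interchanges the two
  simple roots up to sign.\<close>

lemma F4_not_minus:
  "word_action F4 [1, 2, 1] (axis 1 1) \<noteq> - axis 1 1"
  "word_action F4 [3, 4, 3] (axis 3 1) \<noteq> - axis 3 1"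
  "word_action F4 [1, 2, 1, 4] (axis 1 1) \<noteq> - axis 1 1"
  "word_action F4 [1, 3, 4, 3] (axis 3 1) \<noteq> - axis 3 1"
  unfolding F4_act_axis unfolding vec_eq_iff forall_4 by (simp_all add: axis_def)

lemma F4_act_w1234: "word_action F4 F4_w1234 v = - v"
proof -
  obtain a b c d where v: "v = F4_vec a b c d" by (rule F4_vec_cases)
  show ?thesis unfolding v by (simp add: algebra_simps) (simp add: vec_eq_iff forall_4)
qed


lemma F4_act_append_w1234: "word_action F4 (F4_w1234 @ u) v = - word_action F4 u v"
  unfolding word_action_append by (rule F4_act_w1234)

text \<open>Components of type A1, B2, B3 and F4 have longest element -1. The second alternative
  collects the four subsets with a component of type A2.\<close>

lemma F4_longest_word_cases:
  "(\<exists>w\<in>{[], [1], [2], [3], [4], [1, 3], [1, 4], [2, 4], [2, 3, 2, 3],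
      F4_w123, F4_w234, F4_w1234}. F4.longest_word I w)
   \<or> (\<exists>w. F4.longest_word I w \<and> (\<exists>s\<in>I. word_action F4 w (axis s 1) \<noteq> - axis s 1))"
    (is "?P I \<or> ?Q I")
proof -
  have P: "?P {}" "?P {1}" "?P {2}" "?P {3}" "?P {4}"
    "?P {1, 3}" "?P {1, 4}" "?P {2, 4}" "?P {2, 3}" "?P {1, 2, 3}"
    "?P {2, 3, 4}" "?P {1, 2, 3, 4}"
    unfolding bex_simps by (simp_all only: F4_longest_word simp_thms)
  have Q: "?Q {1, 2}" "?Q {3, 4}" "?Q {1, 2, 4}" "?Q {1, 3, 4}"
    using F4_longest_word F4_not_minus by blast+
  have "I \<in> Pow {1, 2, 3, 4}"
    using UNIV_4 by auto
  then have "I \<in> {{}, {1}, {2}, {3}, {4}, {1, 3}, {1, 4}, {2, 4}, {2, 3}, {1, 2, 3},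
      {2, 3, 4}, {1, 2, 3, 4}, {1, 2}, {3, 4}, {1, 2, 4}, {1, 3, 4}}"
    by (simp only: Pow_insert Pow_empty image_insert image_empty insert_iff Un_iff empty_iff image_Un simp_thms)
      (elim disjE; simp only: simp_thms)
  then show ?thesis
    by (elim insertE emptyE; hypsubst) (rule disjI1 disjI2, rule P Q)+
qed

subsection \<open>Invariants of conjugacy classes\<close>

text \<open>\<open>True\<close> stands for the value 1 of the sign that is -1 exactly on the
  generators in \<open>I\<close>.\<close>

definition F4_parity :: "4 set \<Rightarrow> 4 list \<Rightarrow> bool" where
  "F4_parity I u \<longleftrightarrow> even (length (filter (\<lambda>s. s \<in> I) u))"

text \<open>
  The only edge between the node sets \<open>{1, 2}\<close> and \<open>{3, 4}\<close> has an even label, so the number of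
  letters in either set is a homomorphism modulo two.
\<close>

lemma F4_parity_cong:
  assumes "cox_equiv F4 u v" "I = {1, 2} \<or> I = {3, 4}"
  shows "F4_parity I u = F4_parity I v"
  using assms
proof induction
  case (cox_relation u s t v)
  have len: "length (filter P (concat (replicate n [s, t]))) = n * length (filter P [s, t])"
    for P n by (induction n) auto
  have "even (F4 s t) \<or> (s \<in> I \<longleftrightarrow> t \<in> I)"
    using exhaust_4[of s] exhaust_4[of t] cox_relation
    by (elim disjE; hypsubst) (simp_all add: F4_def doubleton_eq_iff)
  then show ?case by (auto simp: F4_parity_def len)
qed auto

definition F4_invariant :: "4 list \<Rightarrow> bool \<times> bool \<times> real" where
  "F4_invariant u = (F4_parity {1, 2} u, F4_parity {3, 4} u, trace (matrix (word_action F4 u)))"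

lemma trace_act_append_commute:
  "trace (matrix (word_action m (u @ v))) = trace (matrix (word_action m (v @ u)))"
proof -
  have "matrix (word_action m (u @ v)) = matrix (word_action m u) ** matrix (word_action m v)" for u v
    using matrix_compose[OF linear_word_action linear_word_action, of m u m v]
    by (simp add: comp_def word_action_append[symmetric])
  then show ?thesis using trace_mul_sym by metis
qed

lemma F4_invariant_conj:
  assumes "cox_equiv F4 (g @ u @ rev g) v"
  shows "F4_invariant u = F4_invariant v"
proof -
  \<comment> \<open>The letters of \<open>g\<close> and \<open>rev g\<close> cancel modulo
    two.\<close>
  have "F4_parity I u = F4_parity I v" if "I = {1, 2} \<or> I = {3, 4}" for I
    using F4_parity_cong[OF assms that] by (auto simp: F4_parity_def rev_filter[symmetric])
  moreover have "trace (matrix (word_action F4 u)) = trace (matrix (word_action F4 v))"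
  proof -
    have "word_action F4 ((u @ rev g) @ g) = word_action F4 u"
      by (simp add: fun_eq_iff word_action_append)
    then show ?thesis
      using trace_act_append_commute[of F4 g "u @ rev g"] F4.act_cong[OF assms] by simp
  qed
  ultimately show ?thesis by (simp add: F4_invariant_def)
qed

lemma trace_F4:
  "trace (matrix (word_action F4 u)) =
     word_action F4 u (F4_vec 1 0 0 0) $ 1 + word_action F4 u (F4_vec 0 1 0 0) $ 2
     + word_action F4 u (F4_vec 0 0 1 0) $ 3 / sqrt 2 + word_action F4 u (F4_vec 0 0 0 1) $ 4 / sqrt 2"
  by (simp add: trace_def sum_4 matrix_def F4_act_axis)

text \<open>The trace is 4 minus twice the dimension of the -1 eigenspace; representatives of equal
  trace differ in the parities.\<close>

lemma F4_invariant_values: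
  "F4_invariant [] = (True, True, 4)"
  "F4_invariant F4_w1234 = (True, True, -4)"
  "F4_invariant [1] = (False, True, 2)"
  "F4_invariant F4_w234 = (False, True, -2)"
  "F4_invariant [3] = (True, False, 2)"
  "F4_invariant F4_w123 = (True, False, -2)"
  "F4_invariant [1, 3] = (False, False, 0)"
  "F4_invariant [2, 3, 2, 3] = (True, True, 0)"
  by (simp_all add: F4_invariant_def F4_parity_def trace_F4)

text \<open>The prefix has twelve letters in either node set, so both characters are 1 on it, and it
  acts as -1.\<close>

lemma F4_invariant_append_w1234:
  "F4_invariant (F4_w1234 @ u) = (case F4_invariant u of (p, q, t) \<Rightarrow> (p, q, - t))"
proof -
  have "trace (matrix (word_action F4 (F4_w1234 @ u))) = - trace (matrix (word_action F4 u))"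
    unfolding trace_F4 F4_act_append_w1234 by simp
  moreover have "F4_parity I (F4_w1234 @ u) = F4_parity I u" if "I = {1, 2} \<or> I = {3, 4}" for I
    using that by (auto simp: F4_parity_def)
  ultimately show ?thesis by (simp add: F4_invariant_def del: append_Cons)
qed

subsection \<open>Classification\<close>

abbreviation F4_involution :: "4 list \<Rightarrow> bool" where
  "F4_involution u \<equiv> cox_equiv F4 (u @ u) []"

abbreviation F4_class :: "4 list \<Rightarrow> 4 list set set" where
  "F4_class u \<equiv> conj_class W_F4 (cox_elem F4 u)"

abbreviation F4_representatives :: "4 list list" where
  "F4_representatives \<equiv>
     [[], F4_w1234, [1], F4_w234, [3], F4_w123, [1, 3], [2, 3, 2, 3]]"

lemma F4_class_eqI:
  assumes "cox_equiv F4 (g @ v @ rev g) u" shows "F4_class u = F4_class v"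
  using group.conj_class_eq[OF group_W_F4, of "cox_elem F4 v" "cox_elem F4 u"] assms
    F4.conj_class_mem_iff[of u v]
  by (auto simp: F4.carrier_elem)

lemma F4_invariant_eq_if_class_eq:
  assumes "F4_class u = F4_class v" shows "F4_invariant u = F4_invariant v"
proof -
  have "cox_elem F4 u \<in> F4_class u"
    unfolding F4.conj_class_mem_iff by (rule exI[of _ "[]"]) (simp add: cox_refl)
  then show ?thesis
    using F4.conj_class_mem_iff[of u v] F4_invariant_conj assms by metis
qed

lemma F4_conj_generators:
  "F4_class [2] = F4_class [1]" "F4_class [4] = F4_class [3]"
  "F4_class [1, 4] = F4_class [1, 3]" "F4_class [2, 4] = F4_class [1, 3]"
  \<comment> \<open>Across an edge with label 3, conjugation by \<open>[s, t]\<close> carries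
    \<open>s\<close> to \<open>t\<close>. Here \<open>[3, 4]\<close> fixes node 1, and
    \<open>[1, 2, 3, 4]\<close> moves both nodes of \<open>[1, 3]\<close>.\<close>
  by (rule F4_class_eqI[of "[1, 2]"] F4_class_eqI[of "[3, 4]"] F4_class_eqI[of "[1, 2, 3, 4]"],
      rule F4_equivI, simp add: algebra_simps)+

lemma F4_involution_representative:
  assumes "F4_involution u"
  shows "\<exists>w\<in>set F4_representatives. F4_class u = F4_class w"
proof -
  obtain I g where gI: "\<forall>w. F4.longest_word I w \<longrightarrow>
      cox_equiv F4 (g @ w @ rev g) u \<and> (\<forall>s\<in>I. word_action F4 w (axis s 1) = - axis s 1)"
    by (rule F4.involution_conj_longest[OF assms])
  \<comment> \<open>This excludes the subsets with a component of type A2.\<close>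
  have "\<nexists>w. F4.longest_word I w \<and> (\<exists>s\<in>I. word_action F4 w (axis s 1) \<noteq> - axis s 1)"
    using gI by fast
  then obtain w where w: "w \<in> {[], [1], [2], [3], [4], [1, 3], [1, 4], [2, 4], [2, 3, 2, 3],
      F4_w123, F4_w234, F4_w1234}" "F4.longest_word I w"
    using F4_longest_word_cases[of I] by (elim disjE bexE) simp_all
  have "F4_class w \<in> F4_class ` set F4_representatives"
    using w(1) by (elim insertE emptyE; hypsubst;
        simp only: F4_conj_generators list.set image_insert image_empty insert_iff simp_thms)
  moreover have "F4_class u = F4_class w"
    using gI w(2) by (intro F4_class_eqI[of g]) blast
  ultimately show ?thesis by (simp only: image_iff)
qed

lemma F4_involution_representatives:
  assumes "w \<in> set F4_representatives" shows "F4_involution w"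
proof -
  have "word_action F4 w (word_action F4 w (F4_vec a b c d)) = F4_vec a b c d" for a b c d
    using assms unfolding list.set
    by (elim insertE emptyE; hypsubst) (simp_all add: algebra_simps)
  then show ?thesis by (intro F4_equivI) (simp add: word_action_append)
qed

lemma distinct_F4_invariants: "distinct (map F4_invariant F4_representatives)"
  by (simp only: list.map F4_invariant_values) simp

text \<open>Each class of involutions contains one of eight representatives, and their invariants
  are distinct.\<close>

lemma F4_class_eq_iff:
  assumes "F4_involution u" "F4_involution v"
  shows "F4_class u = F4_class v \<longleftrightarrow> F4_invariant u = F4_invariant v"
proof
  assume eq: "F4_invariant u = F4_invariant v"
  obtain w where w: "w \<in> set F4_representatives" "F4_class u = F4_class w"
    by (rule bexE[OF F4_involution_representative[OF assms(1)]])
  obtain w' where w': "w' \<in> set F4_representatives" "F4_class v = F4_class w'"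
    by (rule bexE[OF F4_involution_representative[OF assms(2)]])
  have "F4_invariant w = F4_invariant w'"
    using eq F4_invariant_eq_if_class_eq[OF w(2)] F4_invariant_eq_if_class_eq[OF w'(2)]
    by (simp only:)
  have "inj_on F4_invariant (set F4_representatives)"
    using distinct_F4_invariants unfolding distinct_map by (rule conjunct2)
  from this \<open>F4_invariant w = F4_invariant w'\<close> w(1) w'(1) have "w = w'"
    by (rule inj_onD)
  then show "F4_class u = F4_class v"
    using w(2) w'(2) by (simp only:)
qed (rule F4_invariant_eq_if_class_eq)

section \<open>Multiplication of classes by the longest element\<close>

lemma F4_w1234_central: "cox_equiv F4 (F4_w1234 @ u) (u @ F4_w1234)"
  unfolding F4.act_faithful[symmetric] fun_eq_iff word_action_append F4_act_w1234
  by (simp add: linear_neg[OF linear_word_action])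

text \<open>A central factor passes through conjugation, so the translate of a class is again a
  class.\<close>

lemma F4_w1234_l_coset_class:
  "cox_elem F4 F4_w1234 <#\<^bsub>W_F4\<^esub> F4_class u = F4_class (F4_w1234 @ u)"
proof -
  have "cox_elem F4 (F4_w1234 @ g @ u @ rev g) = cox_elem F4 (g @ (F4_w1234 @ u) @ rev g)" for g
    using cox_equiv_context[OF F4_w1234_central, of "[]" g "u @ rev g"]
    by (simp only: cox_elem_eq_iff append_assoc append_Nil)
  moreover have "F4_class u = range (\<lambda>g. cox_elem F4 (g @ u @ rev g))" for u
    by (force simp: conj_class_def F4.carrier_elem F4.inv_elem coxeter_group_mult)
  ultimately show ?thesis
    by (auto simp: l_coset_def coxeter_group_mult simp del: append_Cons)
qed

text \<open>The product of an involution with the central -1 is an involution, so its invariants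
  determine its class.\<close>

lemma F4_w1234_l_coset_class_eq:
  assumes "F4_involution u" "F4_involution v"
    and "F4_invariant v = (case F4_invariant u of (p, q, t) \<Rightarrow> (p, q, - t))"
  shows "cox_elem F4 F4_w1234 <#\<^bsub>W_F4\<^esub> F4_class u = F4_class v"
proof -
  have "F4_involution (F4_w1234 @ u)"
    using F4.act_cong[OF assms(1)]
    unfolding F4.act_faithful[symmetric] fun_eq_iff word_action_append F4_act_w1234
    by (simp add: linear_neg[OF linear_word_action])
  from F4_class_eq_iff[OF this assms(2)] show ?thesis
    unfolding F4_w1234_l_coset_class F4_invariant_append_w1234 assms(3) by (rule iffD2) (rule refl)
qed

lemma F4_classes_of_involutions:
  "conj_class W_F4 ` involutions W_F4 = F4_class ` set F4_representatives"
proof -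
  have mem: "x \<in> involutions W_F4 \<longleftrightarrow> (\<exists>u. x = cox_elem F4 u \<and> F4_involution u)" for x
    unfolding involutions_def F4.carrier_elem F4.one_elem cox_elem_eq_iff[symmetric]
    using coxeter_group_mult[of F4] by auto
  show ?thesis
  proof (intro equalityI subsetI)
    fix C assume "C \<in> conj_class W_F4 ` involutions W_F4"
    then obtain x where "C = conj_class W_F4 x" "x \<in> involutions W_F4" by (rule imageE)
    then obtain u where "F4_involution u" "C = F4_class u" unfolding mem by blast
    then show "C \<in> F4_class ` set F4_representatives"
      using F4_involution_representative[of u] by (simp only: image_iff)
  next
    fix C assume "C \<in> F4_class ` set F4_representatives"
    then obtain w where w: "C = F4_class w" "w \<in> set F4_representatives" by (rule imageE)
    have "cox_elem F4 w \<in> involutions W_F4"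
      unfolding mem using F4_involution_representatives[OF w(2)]
      by (intro exI[of _ w] conjI) simp_all
    then show "C \<in> conj_class W_F4 ` involutions W_F4"
      unfolding w(1) by (rule imageI)
  qed
qed

lemma distinct_F4_classes: "distinct (map F4_class F4_representatives)"
proof -
  have "inj_on F4_class (set F4_representatives)"
    using distinct_F4_invariants unfolding distinct_map
    by (elim conjE) (rule inj_onI, drule F4_invariant_eq_if_class_eq, erule (3) inj_onD)
  then show ?thesis
    using distinct_F4_invariants unfolding distinct_map by (elim conjE) (rule conjI)
qed

theorem mainTheorem9:
  defines "w_o \<equiv> w_F4 UNIV"
  shows
    "w_o \<in> carrier W_F4 \<and>
     (\<forall>x\<in>carrier W_F4. w_o \<otimes>\<^bsub>W_F4\<^esub> x = x \<otimes>\<^bsub>W_F4\<^esub> w_o) \<and>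
     refl_rep F4 w_o = (\<lambda>v. - v) \<and>

     conj_class W_F4 ` involutions W_F4 =
       {cl_F4 {}, cl_F4 {1, 2, 3, 4}, cl_F4 {1}, cl_F4 {2, 3, 4},
        cl_F4 {3}, cl_F4 {1, 2, 3}, cl_F4 {1, 3}, cl_F4 {2, 3}} \<and>
     distinct
       [cl_F4 {}, cl_F4 {1, 2, 3, 4}, cl_F4 {1}, cl_F4 {2, 3, 4},
        cl_F4 {3}, cl_F4 {1, 2, 3}, cl_F4 {1, 3}, cl_F4 {2, 3}] \<and>
     cl_F4 {1} = cl_F4 {2} \<and> cl_F4 {3} = cl_F4 {4} \<and> cl_F4 {1, 3} = cl_F4 {1, 4} \<and>

     w_o <#\<^bsub>W_F4\<^esub> cl_F4 {} = cl_F4 {1, 2, 3, 4} \<and>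
     w_o <#\<^bsub>W_F4\<^esub> cl_F4 {1, 2, 3, 4} = cl_F4 {} \<and>
     w_o <#\<^bsub>W_F4\<^esub> cl_F4 {1} = cl_F4 {2, 3, 4} \<and>
     w_o <#\<^bsub>W_F4\<^esub> cl_F4 {2, 3, 4} = cl_F4 {1} \<and>
     w_o <#\<^bsub>W_F4\<^esub> cl_F4 {3} = cl_F4 {1, 2, 3} \<and>
     w_o <#\<^bsub>W_F4\<^esub> cl_F4 {1, 2, 3} = cl_F4 {3} \<and>
     w_o <#\<^bsub>W_F4\<^esub> cl_F4 {1, 3} = cl_F4 {1, 3} \<and>
     w_o <#\<^bsub>W_F4\<^esub> cl_F4 {2, 3} = cl_F4 {2, 3}"
proof -
  note longest = F4_longest_word[THEN F4.longest_elem_eq]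
  have UNIV: "(UNIV :: 4 set) = {1, 2, 3, 4}" by (rule UNIV_4)
  have w_o: "w_o = cox_elem F4 F4_w1234"
    unfolding w_o_def UNIV by (rule longest)
  have cl: "cl_F4 {} = F4_class []" "cl_F4 {1, 2, 3, 4} = F4_class F4_w1234"
    "cl_F4 {1} = F4_class [1]" "cl_F4 {2, 3, 4} = F4_class F4_w234"
    "cl_F4 {3} = F4_class [3]" "cl_F4 {1, 2, 3} = F4_class F4_w123"
    "cl_F4 {1, 3} = F4_class [1, 3]" "cl_F4 {2, 3} = F4_class [2, 3, 2, 3]"
    "cl_F4 {2} = F4_class [2]" "cl_F4 {4} = F4_class [4]" "cl_F4 {1, 4} = F4_class [1, 4]"
    by (simp_all only: longest)
  have central: "\<forall>x\<in>carrier W_F4. w_o \<otimes>\<^bsub>W_F4\<^esub> x = x \<otimes>\<^bsub>W_F4\<^esub> w_o"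
    unfolding w_o F4.carrier_elem ball_simps coxeter_group_mult cox_elem_eq_iff
    using F4_w1234_central by blast
  have refl: "refl_rep F4 w_o = (\<lambda>v. - v)"
  proof -
    \<comment> \<open>All words in \<open>w_o\<close> act alike, so \<open>the_elem\<close> is
      applied to a singleton.\<close>
    have "F4_w1234 \<in> w_o" by (simp add: w_o cox_elem_def cox_refl)
    moreover have "word_action F4 u = word_action F4 F4_w1234" if "u \<in> w_o" for u
      using that F4.act_cong[of F4_w1234 u] unfolding w_o cox_elem_def by simp
    ultimately have "refl_rep F4 w_o = word_action F4 F4_w1234"
      unfolding refl_rep_def by (intro the_elem_image_unique) blast+
    then show ?thesis by (simp only: fun_eq_iff F4_act_w1234) simp
  qed
  have inv: "F4_involution w" if "w \<in> set F4_representatives" for w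
    using that by (rule F4_involution_representatives)
  \<comment> \<open>The eight products reduce to comparing entries of the table of
    invariants.\<close>
  have coset: "w_o <#\<^bsub>W_F4\<^esub> F4_class u = F4_class v"
    if "u \<in> set F4_representatives" "v \<in> set F4_representatives"
      "F4_invariant v = (case F4_invariant u of (p, q, t) \<Rightarrow> (p, q, - t))" for u v
    unfolding w_o using that inv by (intro F4_w1234_l_coset_class_eq) blast+
  show ?thesis
    unfolding cl F4_conj_generators
    using central refl F4_classes_of_involutions distinct_F4_classes
    by (intro conjI coset; (simp only: list.set list.map image_insert image_empty
      F4_invariant_values)?) (simp_all add: w_o F4.carrier_elem)
qed

end
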